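(* Let $n>2$ be an integer and write $n=3k+r$, where $k$ is a non-negative integer and $r$ is the remainder when $n$ is divided by $3$. Let $f(n)$ be the number of days a king needs to survey the $n\times n$ board using the straight-segment spiral route $S_n$ (defined in the context), i.e. the number of cells of $S_n$. Then \[f(n)=3k^2+2rk+r-2=\left\lfloor\frac{n^2+2}{3}\right\rfloor-2.\]
   Context: Cells of the $n\times n$ board are $(x,y)$ with $1\le x,y\le n$. A king moves in one day from a cell to any horizontally, vertically, or diagonally adjacent cell. A survey of the board in $m$ days by a king is a sequence of cells $p_1,\dots,p_m$, consecutive ones being one king move apart, such that every cell of the board equals some $p_i$ or is one king move away from some $p_i$. The straight-segment spiral $S_n$ is a survey route that moves one cell at a time along straight horizontal and vertical segments, spiralling toward the center: it starts at $(2,2)$, goes to $(n-1,2)$, then to $(n-1,n-1)$, then to $(2,n-1)$, then to $(2,5)$ (first loop), then begins another loop from $(2,5)$ to $(n-4,5)$, and so on, with consecutive loops three cells apart. Precisely: $S_3$ is the single cell $(2,2)$; $S_4$ is $(2,2),(3,2),(3,3),(2,3)$; $S_5$ is $(2,2),(3,2),(4,2),(4,3),(4,4),(3,4),(2,4)$; and for $n\ge 3$, $S_{n+3}$ goes from $(2,2)$ along row $2$ to $(n+2,2)$, up column $n+2$ to $(n+2,n+2)$, left through $(n+1,n+2)$ to $(n,n+2)$ (these are $2n+3$ cells), and then follows the copy of $S_n$, rotated by $180^\circ$, inside the $n\times n$ square of columns $1,\dots,n$ and rows $4,\dots,n+3$ (the cell $(x,y)$ of $S_n$ becoming $(n+1-x,\,n+4-y)$).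 In particular $f(n+3)=f(n)+2n+3$ for $n\ge 3$. *)

theory Defs
  imports Complex_Main
begin

text \<open>
  The route is given as the list of visited cells \<^term>\<open>(x, y)\<close>, in order.
  Coordinates are integers so that subtraction is not truncated. For \<^term>\<open>n \<ge> 6\<close>
  the route \<open>S\<^sub>n\<close> continues with the inner route of size \<^term>\<open>m = n - 3\<close>, turned by
  180 degrees in columns \<open>1, \<dots>, m\<close> and rows \<open>4, \<dots>, m + 3\<close>.
  Boards with \<^term>\<open>n < 3\<close> have no spiral; the value there is a dummy.
\<close>

fun spiral :: "nat \<Rightarrow> (int \<times> int) list" where
  "spiral n =
    (if n < 3 then []
     else if n = 3 then [(2, 2)]
     else if n = 4 then [(2, 2), (3, 2), (3, 3), (2, 3)]
     else if n = 5 then [(2, 2), (3, 2), (4, 2), (4, 3), (4, 4), (3, 4), (2, 4)]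
     else (let m = int n - 3 in
        map (\<lambda>x. (x, 2)) [2..m + 2]
        @ map (\<lambda>y. (m + 2, y)) [3..m + 2]
        @ [(m + 1, m + 2), (m, m + 2)]
        @ map (\<lambda>(x, y). (m + 1 - x, m + 4 - y)) (spiral (n - 3))))"

declare spiral.simps [simp del]

definition spiral_days :: "nat \<Rightarrow> nat" where
  "spiral_days n = length (spiral n)"

end

theory Submission
  imports Defs
begin

text \<open>
  Peeling the outer loop off \<open>S\<^sub>n\<^sub>+\<^sub>3\<close> removes \<open>2n + 3\<close> cells and leaves a rotated copy of
  \<open>S\<^sub>n\<close>, and rotation preserves the number of cells. Writing \<open>n = 3k + r\<close>, the difference
  \<open>2(3k + r) + 3\<close> is exactly the increment of \<open>3k\<^sup>2 + 2rk\<close> from \<open>k\<close> to \<open>k + 1\<close>, so the closed form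
  follows by induction on \<open>k\<close> from the three innermost boards, which have \<open>1\<close>, \<open>4\<close> and \<open>7\<close>
  cells, that is \<open>1 + 3r\<close>.

  For the second form, \<open>(n\<^sup>2 + 2)/3 = 3k\<^sup>2 + 2rk + (r\<^sup>2 + 2)/3\<close>, and
  \<open>r \<le> (r\<^sup>2 + 2)/3 < r + 1\<close> for each \<open>r \<in> {0, 1, 2}\<close>, the values being \<open>2/3\<close>, \<open>1\<close> and \<open>2\<close>.
\<close>

lemma spiral_days_base:
  "spiral_days 3 = 1" "spiral_days 4 = 4" "spiral_days 5 = 7"
  by (simp_all add: spiral_days_def spiral.simps)

text \<open>
  The lengths of the four pieces of the defining equation: \<open>n + 1\<close> cells along the row,
  \<open>n\<close> along the column (whose first cell already belongs to the row), the two connecting cells,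
  and the inner route.
\<close>

lemma spiral_days_add_3:
  assumes "n \<ge> 3"
  shows "spiral_days (n + 3) = spiral_days n + 2 * n + 3"
  unfolding spiral_days_def
  by (subst spiral.simps) (use assms in \<open>simp add: Let_def nat_add_distrib\<close>)

text \<open>
  The closed form at \<open>k + 1\<close>: since \<open>n > 2\<close> forces the quotient to be positive, this shift lets
  the induction start at the innermost boards.
\<close>

lemma spiral_days_closed_form_Suc:
  assumes "r < 3"
  shows "int (spiral_days (3 * Suc k + r)) =
    3 * int (Suc k) ^ 2 + 2 * int r * int (Suc k) + int r - 2"
proof (induction k)
  case 0
  from assms consider "r = 0" | "r = 1" | "r = 2" by linarith
  then show ?case
    by cases (simp_all add: spiral_days_base)
next
  case (Suc k)
  have "spiral_days (3 * Suc (Suc k) + r)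
      = spiral_days (3 * Suc k + r) + 2 * (3 * Suc k + r) + 3"
    using spiral_days_add_3[of "3 * Suc k + r"] by (simp add: algebra_simps)
  with Suc.IH show ?case
    by (simp add: power2_eq_square algebra_simps)
qed

lemma floor_square_plus_2_div_3:
  fixes k r :: nat
  assumes "r < 3"
  shows "\<lfloor>(real (3 * k + r) ^ 2 + 2) / 3\<rfloor> = 3 * int k ^ 2 + 2 * int r * int k + int r"
proof (rule floor_unique)
  from assms consider "r = 0" | "r = 1" | "r = 2" by linarith
  note r_cases = this
  show "of_int (3 * int k ^ 2 + 2 * int r * int k + int r) \<le> (real (3 * k + r) ^ 2 + 2) / 3"
    using r_cases by cases (simp_all add: power2_eq_square field_simps)
  show "(real (3 * k + r) ^ 2 + 2) / 3 < of_int (3 * int k ^ 2 + 2 * int r * int k + int r) + 1"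
    using r_cases by cases (simp_all add: power2_eq_square field_simps)
qed

theorem mainTheorem6:
  fixes n k r :: nat
  assumes "n > 2"
    and "n = 3 * k + r"
    and "r = n mod 3"
  shows "int (spiral_days n) = 3 * int k ^ 2 + 2 * int r * int k + int r - 2
    \<and> 3 * int k ^ 2 + 2 * int r * int k + int r - 2 = \<lfloor>(real n ^ 2 + 2) / 3\<rfloor> - 2"
proof -
  from assms(3) have r: "r < 3" by simp
  with assms(1,2) obtain j where "k = Suc j"
    by (cases k) auto
  with spiral_days_closed_form_Suc[OF r, of j] floor_square_plus_2_div_3[OF r, of k] assms(2)
  show ?thesis by simp
qed

end
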